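(* Let $K$ be a field and let $G$ be the comparability graph of a finite poset on the vertex set $X=\{x_1,\ldots,x_n\}$. Let $\mathrm{cl}(G)$ be its clique clutter. Then the edge ideal $I=I(\mathrm{cl}(G))\subset K[x_1,\ldots,x_n]$ of $\mathrm{cl}(G)$ is normally torsion free (i.e. $I^i=I^{(i)}$ for all $i\geq 1$) and normal (i.e. $I^i=\overline{I^i}$ for all $i\geq 1$).
   Context: The comparability graph of a poset on $X$ has vertex set $X$ and edges all unordered pairs of distinct comparable elements. The clique clutter $\mathrm{cl}(G)$ has vertex set $X$ and its edges are the maximal cliques of $G$ with respect to inclusion (a clique is a set of vertices inducing a complete subgraph). The edge ideal of a clutter $\mathcal{C}$ on $X$ is the ideal of $K[x_1,\ldots,x_n]$ generated by all monomials $\prod_{x_i\in e}x_i$ with $e$ an edge of $\mathcal{C}$. If $C_1,\ldots,C_s$ are the minimal vertex covers of $\mathcal{C}$ (minimal sets of vertices meeting every edge) and $\mathfrak{p}_k$ is the ideal generated by $C_k$, then $I(\mathcal{C})=\mathfrak{p}_1\cap\cdots\cap\mathfrak{p}_s$ and the $i$th symbolic power is $I^{(i)}=\mathfrak{p}_1^i\cap\cdots\cap\mathfrak{p}_s^i$. The integral closure of $I^i$ is $\overline{I^i}=(\{x^a\mid\exists\,p\geq 1:\ (x^a)^p\in I^{pi}\})$. *)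

theory Defs
  imports Complex_Main "HOL-Library.Poly_Mapping"
begin

definition ideal_gen :: "'r::comm_ring_1 set \<Rightarrow> 'r set" where
  "ideal_gen S = module.span (*) S"

lemma module_times: "module ((*) :: 'r \<Rightarrow> 'r \<Rightarrow> 'r::comm_ring_1)"
  by unfold_locales (simp_all add: algebra_simps)

definition ideal_mult :: "'r::comm_ring_1 set \<Rightarrow> 'r set \<Rightarrow> 'r set" where
  "ideal_mult I J = ideal_gen {a * b | a b. a \<in> I \<and> b \<in> J}"

primrec ideal_pow :: "'r::comm_ring_1 set \<Rightarrow> nat \<Rightarrow> 'r set" where
  "ideal_pow I 0 = UNIV"
| "ideal_pow I (Suc i) = ideal_mult I (ideal_pow I i)"

text \<open>For a finite type \<open>'x\<close> with elements \<open>x\<^sub>1, \<dots>, x\<^sub>n\<close>, the polynomial ring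
  \<open>K[x\<^sub>1, \<dots>, x\<^sub>n]\<close> is the type of finitely supported functions from exponent vectors to \<open>K\<close>,
  with convolution as multiplication.\<close>

type_synonym ('x, 'k) mpoly = "('x \<Rightarrow>\<^sub>0 nat) \<Rightarrow>\<^sub>0 'k"

definition monomial :: "('x \<Rightarrow>\<^sub>0 nat) \<Rightarrow> ('x, 'k::comm_ring_1) mpoly" where
  "monomial a = Poly_Mapping.single a 1"

definition var :: "'x \<Rightarrow> ('x, 'k::comm_ring_1) mpoly" where
  "var x = monomial (Poly_Mapping.single x 1)"

text \<open>Graphs and clutters are given by their edge sets; the vertex set is the whole type.\<close>

definition edge_ideal :: "'x set set \<Rightarrow> ('x, 'k::comm_ring_1) mpoly set" where
  "edge_ideal C = ideal_gen {\<Prod>x\<in>e. var x | e. e \<in> C}"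

definition vertex_cover :: "'x set set \<Rightarrow> 'x set \<Rightarrow> bool" where
  "vertex_cover C V \<longleftrightarrow> (\<forall>e\<in>C. V \<inter> e \<noteq> {})"

definition minimal_vertex_cover :: "'x set set \<Rightarrow> 'x set \<Rightarrow> bool" where
  "minimal_vertex_cover C V \<longleftrightarrow> vertex_cover C V \<and> (\<forall>W. W \<subset> V \<longrightarrow> \<not> vertex_cover C W)"

definition symbolic_power :: "'x set set \<Rightarrow> nat \<Rightarrow> ('x, 'k::comm_ring_1) mpoly set" where
  "symbolic_power C i = (\<Inter>V\<in>{V. minimal_vertex_cover C V}. ideal_pow (ideal_gen (var ` V)) i)"

text \<open>The integral closure of the \<open>i\<close>-th power of an ideal \<open>I\<close> generated by monomials.\<close>

definition integral_closure_pow ::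
    "('x, 'k::comm_ring_1) mpoly set \<Rightarrow> nat \<Rightarrow> ('x, 'k) mpoly set" where
  "integral_closure_pow I i =
     ideal_gen {monomial a | a. \<exists>p\<ge>1. monomial a ^ p \<in> ideal_pow I (p * i)}"

definition normally_torsion_free :: "'k::field itself \<Rightarrow> 'x set set \<Rightarrow> bool" where
  "normally_torsion_free K C \<longleftrightarrow>
     (\<forall>i\<ge>1. ideal_pow (edge_ideal C :: ('x, 'k) mpoly set) i = symbolic_power C i)"

definition normal_ideal :: "('x, 'k::field) mpoly set \<Rightarrow> bool" where
  "normal_ideal I \<longleftrightarrow> (\<forall>i\<ge>1. ideal_pow I i = integral_closure_pow I i)"

definition comparability_graph :: "'x rel \<Rightarrow> 'x set set" where
  "comparability_graph r = {{x, y} | x y. x \<noteq> y \<and> ((x, y) \<in> r \<or> (y, x) \<in> r)}"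

definition clique :: "'x set set \<Rightarrow> 'x set \<Rightarrow> bool" where
  "clique G S \<longleftrightarrow> (\<forall>x\<in>S. \<forall>y\<in>S. x \<noteq> y \<longrightarrow> {x, y} \<in> G)"

definition clique_clutter :: "'x set set \<Rightarrow> 'x set set" where
  "clique_clutter G = {S. clique G S \<and> (\<forall>T. S \<subset> T \<longrightarrow> \<not> clique G T)}"

end

theory Submission
  imports Defs
begin

text \<open>Both \<open>I\<^sup>n\<close> and \<open>I\<^bsup>(n)\<^esup>\<close> are monomial ideals. A monomial \<open>x\<^sup>a\<close> lies in the symbolic power iff every
  minimal vertex cover has \<open>a\<close>-weight at least \<open>n\<close>, and in \<open>I\<^sup>n\<close> iff \<open>n\<close> maximal cliques, that is,
  maximal chains, can be packed into \<open>a\<close>. These conditions agree by Menger's theorem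
  for the cover relation with vertex capacities \<open>a\<close>: maximal chains are the paths from minimal to
  maximal elements, and vertex covers are the cuts. Since the weight condition is homogeneous,
  \<open>(x\<^sup>a)\<^sup>p \<in> I\<^sup>p\<^sup>n\<close> already forces \<open>x\<^sup>a \<in> I\<^sup>n\<close>, which is normality.\<close>

section \<open>Routing tokens through a digraph with vertex capacities\<close>

text \<open>The number \<open>b x\<close> counts the tokens that sit at \<open>x\<close> and must still reach \<open>T\<close>; \<open>a x\<close> is the number
  of tokens that may yet enter \<open>x\<close>.\<close>

definition routable :: "'v rel \<Rightarrow> 'v set \<Rightarrow> ('v \<Rightarrow> nat) \<Rightarrow> ('v \<Rightarrow> nat) \<Rightarrow> bool" where
  "routable E T b a \<longleftrightarrow> (\<forall>Q. Q \<inter> T = {} \<longrightarrow> sum b Q \<le> sum a (E `` Q - Q))"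

lemma sum_of_bool_eq_single:
  "finite A \<Longrightarrow> (\<Sum>z\<in>A. of_bool (z = x)) = (of_bool (x \<in> A) :: nat)"
  by (simp add: of_bool_def)

text \<open>Submodularity of the weighted out-boundary: the two sets on the left have their union
  inside the union, and their intersection inside the intersection, of the two sets on the
  right.\<close>

lemma sum_boundary_submodular:
  fixes a :: "'v::finite \<Rightarrow> nat"
  shows "sum a (E `` (P \<union> Q) - (P \<union> Q)) + sum a (E `` (P \<inter> Q) - (P \<inter> Q))
    \<le> sum a (E `` P - P) + sum a (E `` Q - Q)" (is "sum a ?L1 + sum a ?L2 \<le> sum a ?R1 + sum a ?R2")
proof -
  have "sum a ?L1 + sum a ?L2 = sum a (?L1 \<union> ?L2) + sum a (?L1 \<inter> ?L2)"
    by (simp add: sum.union_inter)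
  also have "\<dots> \<le> sum a (?R1 \<union> ?R2) + sum a (?R1 \<inter> ?R2)"
    by (intro add_mono sum_mono2) auto
  also have "\<dots> = sum a ?R1 + sum a ?R2"
    by (simp add: sum.union_inter)
  finally show ?thesis .
qed

text \<open>Uncrossing: \<open>sum b\<close> is modular and the boundary weight submodular, while
  the cut condition holds at both \<open>P \<union> Q\<close> and \<open>P \<inter> Q\<close>.
  Tightness of \<open>P\<close> and \<open>Q\<close> therefore leaves no slack in either.\<close>

lemma tight_union:
  fixes a b :: "'v::finite \<Rightarrow> nat"
  assumes "routable E T b a" "P \<inter> T = {}" "Q \<inter> T = {}"
    and "sum b P = sum a (E `` P - P)" "sum b Q = sum a (E `` Q - Q)"
  shows "sum b (P \<union> Q) = sum a (E `` (P \<union> Q) - (P \<union> Q))"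
proof -
  have "sum b (P \<union> Q) \<le> sum a (E `` (P \<union> Q) - (P \<union> Q))"
    using assms(1-3) unfolding routable_def by (simp add: Int_Un_distrib2)
  moreover have "sum b (P \<inter> Q) \<le> sum a (E `` (P \<inter> Q) - (P \<inter> Q))"
    using assms(1-3) unfolding routable_def by (metis inf.left_commute inf_assoc inf_bot_right)
  moreover have "sum b (P \<union> Q) + sum b (P \<inter> Q) = sum b P + sum b Q"
    by (simp add: sum.union_inter)
  ultimately show ?thesis
    using sum_boundary_submodular[of a E P Q] assms(4,5) by linarith
qed

text \<open>A successor \<open>y\<close> cannot receive the token of \<open>x\<close> only if some tight set avoiding \<open>x\<close>
  contains \<open>y\<close> or has it on its boundary. The union of the tight sets avoiding \<open>x\<close> is tight; if all
  successors were blocked, adding \<open>x\<close> to it would violate the cut condition.\<close>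

lemma routable_step:
  fixes a b :: "'v::finite \<Rightarrow> nat"
  assumes R: "routable E T (\<lambda>z. b z + of_bool (z = x)) a" and "x \<notin> T"
  obtains y a' where "(x, y) \<in> E" "a = (\<lambda>z. a' z + of_bool (z = y))"
    "routable E T (\<lambda>z. b z + of_bool (z = y)) a'"
proof (rule ccontr)
  assume "\<not> thesis"
  note stuck = this[unfolded not_def, rule_format, OF that]
  define tight where "tight Q \<longleftrightarrow> Q \<inter> T = {} \<and> x \<notin> Q \<and> sum b Q = sum a (E `` Q - Q)" for Q
  have cut: "sum b Q + of_bool (x \<in> Q) \<le> sum a (E `` Q - Q)" if "Q \<inter> T = {}" for Q
    using R that unfolding routable_def
    by (simp add: sum.distrib sum_of_bool_eq_single del: sum_of_bool_eq)
  have R0: "routable E T b a"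
    unfolding routable_def using cut add_leD1 by blast
  have blocked: "\<exists>Q. tight Q \<and> y \<in> Q \<union> E `` Q" if y: "(x, y) \<in> E" "a y > 0" for y
  proof -
    define a' where "a' = a(y := a y - 1)"
    have a: "a = (\<lambda>z. a' z + of_bool (z = y))"
      using y by (auto simp: a'_def fun_eq_iff)
    have sa: "sum a S = sum a' S + of_bool (y \<in> S)" for S
      by (subst a) (simp add: sum.distrib sum_of_bool_eq_single)
    obtain Q where Q: "Q \<inter> T = {}" "sum b Q + of_bool (y \<in> Q) > sum a' (E `` Q - Q)"
      using stuck[OF y(1) a] unfolding routable_def sum.distrib sum_of_bool_eq_single[OF finite]
      by (meson not_le)
    \<comment> \<open>Since \<open>y\<close> cannot lie both in \<open>Q\<close> and on its
      boundary, the move costs the cut at \<open>Q\<close> at most one unit. A cut that fails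
      afterwards was thus tight before and did not contain \<open>x\<close>, whose token would have
      been a spare unit.\<close>
    have "tight Q \<and> y \<in> Q \<union> E `` Q"
      using cut[OF Q(1)] Q sa[of "E `` Q - Q"] y(1)
      unfolding tight_def by (auto simp: of_bool_def split: if_splits)
    then show ?thesis by blast
  qed
  define U where "U = \<Union>{Q. tight Q}"
  have "tight (\<Union>\<Q>)" if "finite \<Q>" "\<Q> \<subseteq> {Q. tight Q}" for \<Q>
    using that
  proof (induction \<Q> rule: finite_induct)
    case empty
    show ?case by (simp add: tight_def)
  next
    case (insert Q \<Q>)
    then have "tight Q" "tight (\<Union>\<Q>)" by auto
    then show ?case
      using tight_union[OF R0, of Q "\<Union>\<Q>"] by (auto simp: tight_def Int_Un_distrib2)
  qed
  then have U: "tight U"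
    unfolding U_def by simp
  have reached: "y \<in> U \<union> E `` U" if "(x, y) \<in> E" "a y > 0" for y
    using blocked[OF that] unfolding U_def by blast
  \<comment> \<open>Only successors of \<open>x\<close> with positive capacity could enlarge the
    boundary weight, and these already lie in \<open>U\<close> or on its boundary.\<close>
  have "sum a (E `` insert x U - insert x U)
      = sum a ((E `` insert x U - insert x U) \<inter> {z. a z > 0})"
    by (rule sum.mono_neutral_right) auto
  also have "\<dots> \<le> sum a (E `` U - U)"
    using reached by (intro sum_mono2) auto
  also have "\<dots> = sum b U"
    using U by (simp add: tight_def)
  finally have "sum a (E `` insert x U - insert x U) \<le> sum b (insert x U)"
    using U by (simp add: tight_def)
  moreover have "insert x U \<inter> T = {}"
    using U \<open>x \<notin> T\<close> by (auto simp: tight_def)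
  ultimately show False
    using cut[of "insert x U"] by simp
qed

text \<open>Iterating \<open>routable_step\<close> leads one token from \<open>x\<close> to
  \<open>T\<close>. Each move uses up one unit of capacity, so the total capacity decreases and
  cycles of \<open>E\<close> do no harm. The start \<open>x\<close> is not charged, because capacity
  is paid on entering a vertex.\<close>

lemma routable_path:
  fixes a b :: "'v::finite \<Rightarrow> nat"
  assumes "routable E T (\<lambda>z. b z + of_bool (z = x)) a"
  shows "\<exists>p a'. successively (\<lambda>u v. (u, v) \<in> E) (x # p) \<and> last (x # p) \<in> T \<and>
    a = (\<lambda>z. a' z + count_list p z) \<and> routable E T b a'"
  using assms
proof (induction "sum a UNIV" arbitrary: a x rule: less_induct)
  case less
  show ?case
  proof (cases "x \<in> T")
    case True
    have "routable E T b a"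
      unfolding routable_def
    proof (intro allI impI)
      fix Q assume "Q \<inter> T = {}"
      then have "sum b Q + (\<Sum>z\<in>Q. of_bool (z = x)) \<le> sum a (E `` Q - Q)"
        using less.prems unfolding routable_def sum.distrib by blast
      then show "sum b Q \<le> sum a (E `` Q - Q)"
        by (rule add_leD1)
    qed
    with True show ?thesis
      by (intro exI[of _ "[]"] exI[of _ a]) auto
  next
    case False
    obtain y a' where y: "(x, y) \<in> E" "a = (\<lambda>z. a' z + of_bool (z = y))"
      "routable E T (\<lambda>z. b z + of_bool (z = y)) a'"
      using routable_step[OF less.prems False] .
    have "sum a' UNIV < sum a UNIV"
      unfolding y(2) by (simp add: sum.distrib sum_of_bool_eq_single)
    from less.hyps[OF this y(3)] obtain p a'' where
      p: "successively (\<lambda>u v. (u, v) \<in> E) (y # p)" "last (y # p) \<in> T"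
        "a' = (\<lambda>z. a'' z + count_list p z)" "routable E T b a''"
      by blast
    show ?thesis
      using p y(1,2) by (intro exI[of _ "y # p"] exI[of _ a'']) (auto simp: fun_eq_iff)
  qed
qed

text \<open>Menger's theorem for one source: the tokens at \<open>s\<close> are routed one after
  another, the cut condition surviving for the remaining tokens and the remaining
  capacities.\<close>

lemma routable_path_packing:
  fixes a :: "'v::finite \<Rightarrow> nat"
  assumes "routable E T (\<lambda>z. n * of_bool (z = s)) a"
  shows "\<exists>ps. length ps = n \<and>
    (\<forall>p\<in>set ps. successively (\<lambda>u v. (u, v) \<in> E) (s # p) \<and> last (s # p) \<in> T) \<and>
    (\<forall>z. (\<Sum>p\<leftarrow>ps. count_list p z) \<le> a z)"
  using assms
proof (induction n arbitrary: a)
  case 0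
  show ?case by simp
next
  case (Suc n)
  then have "routable E T (\<lambda>z. n * of_bool (z = s) + of_bool (z = s)) a"
    by (simp add: add.commute)
  from routable_path[OF this] obtain p a' where
    p: "successively (\<lambda>u v. (u, v) \<in> E) (s # p)" "last (s # p) \<in> T"
      "a = (\<lambda>z. a' z + count_list p z)" "routable E T (\<lambda>z. n * of_bool (z = s)) a'"
    by blast
  from Suc.IH[OF p(4)] obtain ps where ps: "length ps = n"
    "\<forall>p\<in>set ps. successively (\<lambda>u v. (u, v) \<in> E) (s # p) \<and> last (s # p) \<in> T"
    "\<forall>z. (\<Sum>p\<leftarrow>ps. count_list p z) \<le> a' z"
    by blast
  show ?case
    using p ps by (intro exI[of _ "p # ps"]) (auto simp: add.commute intro: add_mono)
qed

section \<open>Packing maximal cliques of a comparability graph\<close>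

definition covers :: "'x rel \<Rightarrow> 'x rel" where
  "covers r = {(x, y). (x, y) \<in> r - Id \<and> (\<nexists>z. (x, z) \<in> r - Id \<and> (z, y) \<in> r - Id)}"

lemma clique_comparability_graph:
  "clique (comparability_graph r) S \<longleftrightarrow> (\<forall>x\<in>S. \<forall>y\<in>S. x \<noteq> y \<longrightarrow> (x, y) \<in> r \<or> (y, x) \<in> r)"
  unfolding clique_def comparability_graph_def
  by (auto simp: doubleton_eq_iff)

text \<open>Maximality can be tested by adding single elements, since subsets of cliques are
  cliques.\<close>

lemma clique_clutter_comparability_graph_iff:
  assumes "clique (comparability_graph r) S"
  shows "S \<in> clique_clutter (comparability_graph r) \<longleftrightarrow>
    (\<forall>z. (\<forall>x\<in>S. x = z \<or> (x, z) \<in> r \<or> (z, x) \<in> r) \<longrightarrow> z \<in> S)"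
proof
  assume S: "S \<in> clique_clutter (comparability_graph r)"
  show "\<forall>z. (\<forall>x\<in>S. x = z \<or> (x, z) \<in> r \<or> (z, x) \<in> r) \<longrightarrow> z \<in> S"
  proof (intro allI impI)
    fix z assume "\<forall>x\<in>S. x = z \<or> (x, z) \<in> r \<or> (z, x) \<in> r"
    then have "clique (comparability_graph r) (insert z S)"
      using assms unfolding clique_comparability_graph by auto
    then show "z \<in> S"
      using S unfolding clique_clutter_def by blast
  qed
next
  assume "\<forall>z. (\<forall>x\<in>S. x = z \<or> (x, z) \<in> r \<or> (z, x) \<in> r) \<longrightarrow> z \<in> S"
  then show "S \<in> clique_clutter (comparability_graph r)"
    using assms unfolding clique_clutter_def clique_comparability_graph by blast
qed

lemma minimal_vertex_cover_subset:
  fixes V :: "'x::finite set"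
  assumes "vertex_cover C V"
  obtains W where "W \<subseteq> V" "minimal_vertex_cover C W"
proof -
  have "\<exists>W. minimal_vertex_cover C W \<and> W \<subseteq> V"
    using finite_has_minimal2[of "{W. vertex_cover C W}" V] assms
    unfolding minimal_vertex_cover_def by (auto simp: psubset_eq)
  then show ?thesis using that by blast
qed

section \<open>Saturated chains and cuts in the Hasse diagram of a finite poset\<close>

context
  fixes r :: "'x::finite rel"
  assumes po: "partial_order_on UNIV r"
begin

lemma po_trans: "(x, y) \<in> r \<Longrightarrow> (y, z) \<in> r \<Longrightarrow> (x, z) \<in> r"
  and po_antisym: "(x, y) \<in> r \<Longrightarrow> (y, x) \<in> r \<Longrightarrow> x = y"
  using po unfolding partial_order_on_def preorder_on_def trans_def antisym_def
  by blast+

lemma strict_trans: "trans (r - Id)"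
  by (auto intro!: transI intro: po_trans dest: po_antisym)

lemma acyclic_strict: "acyclic (r - Id)"
  unfolding acyclic_def trancl_id[OF strict_trans] by simp

lemma wf_strict: "wf (r - Id)"
  by (rule finite_acyclic_wf[OF finite acyclic_strict])

lemma wf_strict_converse: "wf ((r - Id)\<inverse>)"
  by (rule finite_acyclic_wf_converse[OF finite acyclic_strict])

lemma successively_covers_chain:
  assumes "successively (\<lambda>u v. (u, v) \<in> covers r) p"
  shows "sorted_wrt (\<lambda>u v. (u, v) \<in> r - Id) p"
proof -
  have "transp (\<lambda>u v. (u, v) \<in> r - Id)"
    by (rule transpI) (rule transD[OF strict_trans])
  moreover have "successively (\<lambda>u v. (u, v) \<in> r - Id) p"
    using assms by (rule successively_mono) (auto simp: covers_def)
  ultimately show ?thesis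
    by (rule successively_conv_sorted_wrt[THEN iffD1])
qed

text \<open>An element \<open>z\<close> outside \<open>p\<close> but comparable to all of it lies
  above the minimal head, and it cannot fit between consecutive elements. So it climbs past every
  element of \<open>p\<close> and ends up above the maximal last one, which is absurd.\<close>

lemma saturated_chain_in_clutter:
  assumes succ: "successively (\<lambda>u v. (u, v) \<in> covers r) p" and "p \<noteq> []"
    and min: "\<And>z. (z, hd p) \<in> r \<Longrightarrow> z = hd p" and max: "\<And>z. (last p, z) \<in> r \<Longrightarrow> z = last p"
  shows "set p \<in> clique_clutter (comparability_graph r)"
proof -
  have sorted: "(p ! i, p ! j) \<in> r" if "i < j" "j < length p" for i j
    using sorted_wrt_nth_less[OF successively_covers_chain[OF succ] that] by simp
  have clique: "clique (comparability_graph r) (set p)"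
    unfolding clique_comparability_graph
  proof (intro ballI impI)
    fix x y assume "x \<in> set p" "y \<in> set p" and "x \<noteq> y"
    then obtain i j where ij: "i < length p" "j < length p" "x = p ! i" "y = p ! j"
      unfolding in_set_conv_nth by blast
    with \<open>x \<noteq> y\<close> have "i \<noteq> j" by blast
    then show "(x, y) \<in> r \<or> (y, x) \<in> r"
      using sorted[of i j] sorted[of j i] ij by (simp add: nat_neq_iff) blast
  qed
  have "z \<in> set p" if z: "\<forall>x\<in>set p. x = z \<or> (x, z) \<in> r \<or> (z, x) \<in> r" for z
  proof (rule ccontr)
    assume "z \<notin> set p"
    have comparable: "(x, z) \<in> r - Id \<or> (z, x) \<in> r - Id" if "x \<in> set p" for x
      using z[rule_format, OF that] \<open>z \<notin> set p\<close> that by blast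
    have above: "(p ! i, z) \<in> r - Id" if "i < length p" for i
      using that
    proof (induction i)
      case 0
      have "(hd p, z) \<in> r - Id"
        using comparable[OF hd_in_set[OF \<open>p \<noteq> []\<close>]] min[of z] by blast
      then show ?case by (simp only: hd_conv_nth[OF \<open>p \<noteq> []\<close>])
    next
      case (Suc i)
      have "(p ! i, z) \<in> r - Id" using Suc by simp
      moreover have "(p ! i, p ! Suc i) \<in> covers r"
        using succ Suc.prems unfolding successively_conv_nth by blast
      ultimately have "(z, p ! Suc i) \<notin> r - Id"
        unfolding covers_def by blast
      then show ?case
        using comparable[OF nth_mem[OF Suc.prems]] by blast
    qed
    have "(last p, z) \<in> r - Id"
      using above[of "length p - 1"] \<open>p \<noteq> []\<close> by (simp add: last_conv_nth)
    then show False using max[of z] by auto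
  qed
  then show "set p \<in> clique_clutter (comparability_graph r)"
    by (simp add: clique_clutter_comparability_graph_iff[OF clique])
qed

text \<open>Turns cuts of the Hasse diagram into vertex covers. A maximal chain avoiding
  \<open>V\<close> starts at a minimal element, hence in \<open>Q\<close>, and no covering step
  leaves \<open>Q\<close>; but it must end at a maximal element, and \<open>Q\<close> has
  none.\<close>

lemma vertex_cover_cut:
  assumes min: "\<And>x. (\<nexists>z. (z, x) \<in> r - Id) \<Longrightarrow> x \<in> Q \<union> V"
    and cov: "\<And>x y. x \<in> Q \<Longrightarrow> (x, y) \<in> covers r \<Longrightarrow> y \<in> Q \<union> V"
    and max: "\<And>x. x \<in> Q \<Longrightarrow> \<exists>z. (x, z) \<in> r - Id"
  shows "vertex_cover (clique_clutter (comparability_graph r)) V"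
  unfolding vertex_cover_def
proof (intro ballI notI)
  fix e assume e: "e \<in> clique_clutter (comparability_graph r)" "V \<inter> e = {}"
  then have "clique (comparability_graph r) e"
    by (simp add: clique_clutter_def)
  note chain = this[unfolded clique_comparability_graph, rule_format]
    and maximal = clique_clutter_comparability_graph_iff[OF this, THEN iffD1, OF e(1), rule_format]
  have sub: "x \<in> Q" if "x \<in> e" for x
    using wf_strict that
  proof (induction x rule: wf_induct_rule)
    case (less x)
    show ?case
    proof (cases "\<exists>y\<in>e. (y, x) \<in> r - Id")
      case False
      \<comment> \<open>Here \<open>x\<close> is the least element of \<open>e\<close>. Anything
        below it would be comparable to all of \<open>e\<close> and hence belong to
        \<open>e\<close>.\<close>
      have "\<nexists>z. (z, x) \<in> r - Id"
      proof
        assume "\<exists>z. (z, x) \<in> r - Id"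
        then obtain z where z: "(z, x) \<in> r - Id" by blast
        have below: "(z, w) \<in> r" if "w \<in> e" for w
          using that False z chain[of x w] less.prems by (auto intro: po_trans)
        then have "z \<in> e" using maximal by blast
        with False z show False by blast
      qed
      then show ?thesis using min e(2) less.prems by blast
    next
      case True
      define L where "L = {y \<in> e. (y, x) \<in> r - Id}"
      obtain y where y: "y \<in> L" "\<And>w. (w, y) \<in> (r - Id)\<inverse> \<Longrightarrow> w \<notin> L"
        using True wfE_min[OF wf_strict_converse, of _ L] unfolding L_def by blast
      have "(y, x) \<in> covers r"
      proof (rule ccontr)
        assume "(y, x) \<notin> covers r"
        then obtain z where z: "(y, z) \<in> r - Id" "(z, x) \<in> r - Id"
          using y(1) unfolding covers_def L_def by blast
        \<comment> \<open>A \<open>z\<close> strictly between \<open>y\<close> and \<open>x\<close>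
          is comparable to all of \<open>e\<close>: elements from \<open>x\<close> upwards lie above
          it, all others lie in \<open>L\<close>, hence at or below its largest element
          \<open>y\<close>.\<close>
        have "w = z \<or> (w, z) \<in> r \<or> (z, w) \<in> r" if w: "w \<in> e" for w
        proof (cases "w = x \<or> (x, w) \<in> r")
          case True
          then show ?thesis using z by (auto intro: po_trans)
        next
          case False
          then have "w \<in> L"
            using chain[OF w less.prems] w unfolding L_def by auto
          then have "w = y \<or> (w, y) \<in> r"
            using y chain[of w y] unfolding L_def by blast
          then show ?thesis using z by (auto intro: po_trans)
        qed
        then have "z \<in> L" using maximal z(2) unfolding L_def by blast
        with y(2) z(1) show False by blast
      qed
      moreover have "y \<in> Q"
        using y(1) less.IH unfolding L_def by blast
      ultimately show ?thesis
        using cov e(2) less.prems by blast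
    qed
  qed
  \<comment> \<open>The empty clique is not maximal because a type is inhabited.\<close>
  have "e \<noteq> {}" using maximal by blast
  then obtain m where m: "m \<in> e" "\<And>w. (w, m) \<in> (r - Id)\<inverse> \<Longrightarrow> w \<notin> e"
    using wfE_min[OF wf_strict_converse, of _ e] by blast
  obtain z where z: "(m, z) \<in> r - Id"
    using max sub m(1) by blast
  have "(w, z) \<in> r" if "w \<in> e" for w
    using m that z chain[of w m] by (auto intro: po_trans)
  then have "z \<in> e" using maximal by blast
  with m(2) z show False by blast
qed

text \<open>The element \<open>None\<close> serves as a source below the minimal elements of the poset.\<close>

lemma clique_packing:
  fixes a :: "'x \<Rightarrow> nat"
  assumes "\<And>V. minimal_vertex_cover (clique_clutter (comparability_graph r)) V \<Longrightarrow> n \<le> sum a V"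
  obtains es where "length es = n" "set es \<subseteq> clique_clutter (comparability_graph r)"
    "\<And>x. (\<Sum>e\<leftarrow>es. of_bool (x \<in> e)) \<le> a x"
proof -
  define E :: "'x option rel" where
    "E = {(None, Some x) | x. \<nexists>z. (z, x) \<in> r - Id} \<union> {(Some x, Some y) | x y. (x, y) \<in> covers r}"
  define T where "T = {Some x | x. \<nexists>z. (x, z) \<in> r - Id}"
  \<comment> \<open>The source may have capacity 0 since no edge of \<open>E\<close> enters
    it.\<close>
  have "routable E T (\<lambda>z. n * of_bool (z = None)) (case_option 0 a)"
    unfolding routable_def
  proof (intro allI impI)
    fix Q assume Q: "Q \<inter> T = {}"
    show "(\<Sum>z\<in>Q. n * of_bool (z = None)) \<le> sum (case_option 0 a) (E `` Q - Q)"
    proof (cases "None \<in> Q")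
      case False
      then have "(\<Sum>z\<in>Q. n * of_bool (z = None)) = 0"
        by (intro sum.neutral ballI) (metis mult_0_right of_bool_eq(1))
      then show ?thesis by linarith
    next
      case True
      \<comment> \<open>The boundary of a set containing the source is a vertex cover. The
        hypothesis speaks of minimal covers, so it is applied to one inside
        \<open>V\<close>.\<close>
      define V where "V = {x. Some x \<in> E `` Q - Q}"
      have "vertex_cover (clique_clutter (comparability_graph r)) V"
      proof (rule vertex_cover_cut[of "{x. Some x \<in> Q}"])
        show "x \<in> {x. Some x \<in> Q} \<union> V" if "\<nexists>z. (z, x) \<in> r - Id" for x
          using that True unfolding V_def E_def by blast
        show "y \<in> {x. Some x \<in> Q} \<union> V" if "x \<in> {x. Some x \<in> Q}" "(x, y) \<in> covers r" for x y
          using that unfolding V_def E_def by blast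
        show "\<exists>z. (x, z) \<in> r - Id" if "x \<in> {x. Some x \<in> Q}" for x
          using that Q unfolding T_def by blast
      qed
      then obtain W where W: "W \<subseteq> V" "minimal_vertex_cover (clique_clutter (comparability_graph r)) W"
        by (rule minimal_vertex_cover_subset)
      have "(\<Sum>z\<in>Q. n * of_bool (z = None)) = n"
        using True by (simp add: sum_of_bool_eq_single flip: sum_distrib_left)
      also have "\<dots> \<le> sum a W" using assms W(2) .
      also have "\<dots> = sum (case_option 0 a) (Some ` W)"
        by (simp add: sum.reindex)
      also have "\<dots> \<le> sum (case_option 0 a) (E `` Q - Q)"
        using W(1) by (intro sum_mono2) (auto simp: V_def)
      finally show ?thesis .
    qed
  qed
  from routable_path_packing[OF this] obtain ps where ps: "length ps = n"
    "\<And>p. p \<in> set ps \<Longrightarrow> successively (\<lambda>u v. (u, v) \<in> E) (None # p)"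
    "\<And>p. p \<in> set ps \<Longrightarrow> last (None # p) \<in> T"
    "\<And>z. (\<Sum>p\<leftarrow>ps. count_list p z) \<le> case_option 0 a z"
    by blast
  have path: "set (map the p) \<in> clique_clutter (comparability_graph r) \<and>
      (\<forall>x. of_bool (x \<in> set (map the p)) \<le> count_list p (Some x))" if p: "p \<in> set ps" for p
  proof -
    have "None \<notin> set p"
    proof
      assume "None \<in> set p"
      then obtain i where "i < length p" "p ! i = None" by (meson in_set_conv_nth)
      then have "((None # p) ! i, None) \<in> E"
        using ps(2)[OF p] by (force simp: successively_conv_nth)
      then show False by (auto simp: E_def)
    qed
    define q where "q = map the p"
    have pq: "p = map Some q"
      unfolding q_def using \<open>None \<notin> set p\<close> by (simp, intro map_idI[symmetric]) (metis comp_apply option.exhaust_sel)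
    have "q \<noteq> []"
      using ps(3)[OF p] by (auto simp: pq T_def)
    have succ: "successively (\<lambda>u v. (u, v) \<in> covers r) q"
      using ps(2)[OF p] by (auto simp: pq successively_Cons successively_map E_def)
    \<comment> \<open>The edge out of the source makes the head minimal; arrival in \<open>T\<close>
      makes the last element maximal.\<close>
    have "(None, Some (hd q)) \<in> E"
      using ps(2)[OF p] \<open>q \<noteq> []\<close> by (auto simp: pq successively_Cons hd_map)
    then have min: "z = hd q" if "(z, hd q) \<in> r" for z
      using that by (auto simp: E_def)
    have "Some (last q) \<in> T"
      using ps(3)[OF p] \<open>q \<noteq> []\<close> by (auto simp: pq last_map)
    then have max: "z = last q" if "(last q, z) \<in> r" for z
      using that by (auto simp: T_def)
    have "of_bool (x \<in> set q) \<le> count_list p (Some x)" for x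
      by (cases "x \<in> set q") (auto simp: pq Suc_le_eq count_list_0_iff simp flip: neq0_conv)
    then show ?thesis
      using saturated_chain_in_clutter[OF succ \<open>q \<noteq> []\<close> min max] by (simp add: q_def)
  qed
  show ?thesis
  proof
    show "length (map (\<lambda>p. set (map the p)) ps) = n" using ps(1) by simp
    show "set (map (\<lambda>p. set (map the p)) ps) \<subseteq> clique_clutter (comparability_graph r)"
      using path by auto
    fix x
    have "(\<Sum>e\<leftarrow>map (\<lambda>p. set (map the p)) ps. of_bool (x \<in> e))
        \<le> (\<Sum>p\<leftarrow>ps. count_list p (Some x))"
      using path by (auto simp: o_def simp del: set_map intro!: sum_list_mono)
    also have "\<dots> \<le> a x" using ps(4)[of "Some x"] by simp
    finally show "(\<Sum>e\<leftarrow>map (\<lambda>p. set (map the p)) ps. of_bool (x \<in> e)) \<le> a x" .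
  qed
qed

end

section \<open>Powers of monomial ideals\<close>

lemma ideal_gen_base: "f \<in> S \<Longrightarrow> f \<in> ideal_gen S"
  unfolding ideal_gen_def by (rule module.span_base[OF module_times])

lemma ideal_gen_mult: "f \<in> ideal_gen S \<Longrightarrow> g * f \<in> ideal_gen S"
  unfolding ideal_gen_def by (rule module.span_scale[OF module_times])

lemma ideal_gen_mono: "S \<subseteq> S' \<Longrightarrow> ideal_gen S \<subseteq> ideal_gen S'"
  unfolding ideal_gen_def by (rule module.span_mono[OF module_times])

lemma ideal_gen_subset: "S \<subseteq> ideal_gen S' \<Longrightarrow> ideal_gen S \<subseteq> ideal_gen S'"
  unfolding ideal_gen_def
  by (rule module.span_minimal[OF module_times _ module.subspace_span[OF module_times]])

lemma ideal_gen_sum: "(\<And>i. i \<in> A \<Longrightarrow> f i \<in> ideal_gen S) \<Longrightarrow> sum f A \<in> ideal_gen S"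
  unfolding ideal_gen_def by (rule module.span_sum[OF module_times])

lemma poly_mapping_eq_sum_single: "f = (\<Sum>m\<in>Poly_Mapping.keys f. Poly_Mapping.single m (Poly_Mapping.lookup f m))"
proof (rule poly_mapping_eqI)
  fix k
  have "Poly_Mapping.lookup (\<Sum>m\<in>Poly_Mapping.keys f. Poly_Mapping.single m (Poly_Mapping.lookup f m)) k
      = (\<Sum>m\<in>Poly_Mapping.keys f. if m = k then Poly_Mapping.lookup f m else 0)"
    unfolding lookup_sum by (intro sum.cong) (auto simp: lookup_single)
  then show "Poly_Mapping.lookup f k = Poly_Mapping.lookup (\<Sum>m\<in>Poly_Mapping.keys f. Poly_Mapping.single m (Poly_Mapping.lookup f m)) k"
    by (simp add: in_keys_iff)
qed

text \<open>Upper bound for the span in \<open>ideal_gen_monomial\<close>. Closure under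
  multiplication holds because each exponent of \<open>g * f\<close> is an exponent of
  \<open>f\<close> plus another one.\<close>

lemma subspace_multiples:
  "module.subspace (*) {f :: ('x, 'k::comm_ring_1) mpoly. \<forall>m\<in>Poly_Mapping.keys f. \<exists>a\<in>A. \<exists>c. m = a + c}"
proof (rule module.subspaceI[OF module_times], goal_cases)
  case 1
  show ?case by simp
next
  case (2 f g)
  then show ?case using keys_add[of f g] by blast
next
  case (3 g f)
  have "\<exists>a\<in>A. \<exists>c. m = a + c" if m: "m \<in> Poly_Mapping.keys (g * f)" for m
  proof -
    obtain u v where uv: "m = u + v" "v \<in> Poly_Mapping.keys f"
      using m keys_mult[of g f] by blast
    then obtain a c where "a \<in> A" "v = a + c"
      using 3 by blast
    then have "a \<in> A" "m = a + (u + c)"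
      using uv(1) by (simp_all add: add.left_commute)
    then show ?thesis by blast
  qed
  then show ?case by simp
qed

text \<open>Membership in a monomial ideal is decided term by term, which reduces the ideals below
  to conditions on exponents. Conversely, each term of such an \<open>f\<close> is a multiple of a
  generator.\<close>

lemma ideal_gen_monomial:
  "ideal_gen (monomial ` A :: ('x, 'k::comm_ring_1) mpoly set)
    = {f. \<forall>m\<in>Poly_Mapping.keys f. \<exists>a\<in>A. \<exists>c. m = a + c}"
proof
  show "ideal_gen (monomial ` A :: ('x, 'k) mpoly set)
    \<subseteq> {f. \<forall>m\<in>Poly_Mapping.keys f. \<exists>a\<in>A. \<exists>c. m = a + c}"
    unfolding ideal_gen_def
  proof (rule module.span_minimal[OF module_times _ subspace_multiples])
    show "monomial ` A \<subseteq> {f :: ('x, 'k) mpoly. \<forall>m\<in>Poly_Mapping.keys f. \<exists>a\<in>A. \<exists>c. m = a + c}"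
      by (auto simp: monomial_def) (metis add.right_neutral)
  qed
  show "{f. \<forall>m\<in>Poly_Mapping.keys f. \<exists>a\<in>A. \<exists>c. m = a + c}
    \<subseteq> ideal_gen (monomial ` A :: ('x, 'k) mpoly set)"
  proof
    fix f :: "('x, 'k) mpoly"
    assume f: "f \<in> {f. \<forall>m\<in>Poly_Mapping.keys f. \<exists>a\<in>A. \<exists>c. m = a + c}"
    have "(\<Sum>m\<in>Poly_Mapping.keys f. Poly_Mapping.single m (Poly_Mapping.lookup f m))
        \<in> ideal_gen (monomial ` A)"
    proof (rule ideal_gen_sum)
      fix m assume "m \<in> Poly_Mapping.keys f"
      then obtain a c where "a \<in> A" "m = c + a"
        using f by (auto simp: add.commute)
      then have "Poly_Mapping.single m (Poly_Mapping.lookup f m)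
          = Poly_Mapping.single c (Poly_Mapping.lookup f m) * monomial a"
        by (simp add: monomial_def mult_single)
      with \<open>a \<in> A\<close> show "Poly_Mapping.single m (Poly_Mapping.lookup f m) \<in> ideal_gen (monomial ` A)"
        by (simp add: ideal_gen_mult ideal_gen_base)
    qed
    then show "f \<in> ideal_gen (monomial ` A)"
      by (simp only: poly_mapping_eq_sum_single[symmetric])
  qed
qed

lemma ideal_mult_monomial:
  "ideal_mult (ideal_gen (monomial ` A)) (ideal_gen (monomial ` B))
    = (ideal_gen (monomial ` {a + b | a b. a \<in> A \<and> b \<in> B}) :: ('x, 'k::comm_ring_1) mpoly set)"
  (is "_ = ideal_gen (_ ` ?AB)")
proof
  show "ideal_mult (ideal_gen (monomial ` A)) (ideal_gen (monomial ` B))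
      \<subseteq> (ideal_gen (monomial ` ?AB) :: ('x, 'k) mpoly set)"
    unfolding ideal_mult_def
  proof (intro ideal_gen_subset subsetI)
    fix h :: "('x, 'k) mpoly"
    assume "h \<in> {f * g | f g. f \<in> ideal_gen (monomial ` A) \<and> g \<in> ideal_gen (monomial ` B)}"
    then obtain f g where h: "h = f * g"
      and fg: "f \<in> ideal_gen (monomial ` A)" "g \<in> ideal_gen (monomial ` B)"
      by (elim CollectE exE conjE)
    have "\<exists>s\<in>?AB. \<exists>c. m = s + c" if m: "m \<in> Poly_Mapping.keys (f * g)" for m
    proof -
      obtain u v where uv: "m = u + v" "u \<in> Poly_Mapping.keys f" "v \<in> Poly_Mapping.keys g"
        using m keys_mult[of f g] by blast
      obtain a c where a: "a \<in> A" "u = a + c"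
        using fg(1) uv(2) unfolding ideal_gen_monomial by blast
      obtain b d where b: "b \<in> B" "v = b + d"
        using fg(2) uv(3) unfolding ideal_gen_monomial by blast
      have "m = (a + b) + (c + d)"
        unfolding uv a b by (simp only: ac_simps)
      moreover have "a + b \<in> ?AB" using a(1) b(1) by blast
      ultimately show ?thesis by (intro bexI exI)
    qed
    then show "h \<in> ideal_gen (monomial ` ?AB)"
      unfolding ideal_gen_monomial h by (intro CollectI ballI)
  qed
  have "monomial ` ?AB \<subseteq> {f * g :: ('x, 'k) mpoly | f g.
      f \<in> ideal_gen (monomial ` A) \<and> g \<in> ideal_gen (monomial ` B)}"
  proof
    fix h :: "('x, 'k) mpoly"
    assume "h \<in> monomial ` ?AB"
    then obtain a b where ab: "a \<in> A" "b \<in> B" "h = monomial (a + b)"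
      by (elim imageE CollectE exE conjE) simp
    have "h = monomial a * monomial b"
      by (simp add: ab monomial_def mult_single)
    then show "h \<in> {f * g | f g. f \<in> ideal_gen (monomial ` A) \<and> g \<in> ideal_gen (monomial ` B)}"
      using ab(1,2) by (intro CollectI exI[of _ "monomial a"] exI[of _ "monomial b"] conjI
          ideal_gen_base imageI)
  qed
  then show "(ideal_gen (monomial ` ?AB) :: ('x, 'k) mpoly set)
      \<subseteq> ideal_mult (ideal_gen (monomial ` A)) (ideal_gen (monomial ` B))"
    unfolding ideal_mult_def by (rule ideal_gen_mono)
qed

text \<open>Exponents of the generators of an n-th power, when \<open>A\<close> holds the exponents
  of the generators. Lists allow a generator to be repeated.\<close>

definition nfold_sums :: "'a::comm_monoid_add set \<Rightarrow> nat \<Rightarrow> 'a set" where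
  "nfold_sums A n = {sum_list as | as. length as = n \<and> set as \<subseteq> A}"

lemma nfold_sums_0 [simp]: "nfold_sums A 0 = {0}"
  by (auto simp: nfold_sums_def)

lemma nfold_sums_Suc: "nfold_sums A (Suc n) = {a + b | a b. a \<in> A \<and> b \<in> nfold_sums A n}"
proof (intro equalityI subsetI)
  fix s assume "s \<in> nfold_sums A (Suc n)"
  then show "s \<in> {a + b | a b. a \<in> A \<and> b \<in> nfold_sums A n}"
    unfolding nfold_sums_def by (fastforce simp: length_Suc_conv)
next
  fix s assume "s \<in> {a + b | a b. a \<in> A \<and> b \<in> nfold_sums A n}"
  then obtain a as where "s = sum_list (a # as)" "length as = n" "set as \<subseteq> A" "a \<in> A"
    unfolding nfold_sums_def by auto
  then show "s \<in> nfold_sums A (Suc n)"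
    unfolding nfold_sums_def by (intro CollectI exI[of _ "a # as"]) simp
qed

lemma ideal_pow_monomial:
  "ideal_pow (ideal_gen (monomial ` A)) n
    = (ideal_gen (monomial ` nfold_sums A n) :: ('x, 'k::comm_ring_1) mpoly set)"
proof (induction n)
  case 0
  show ?case unfolding nfold_sums_0 ideal_gen_monomial by simp
next
  case (Suc n)
  then show ?case by (simp add: ideal_mult_monomial nfold_sums_Suc)
qed

lemma monomial_in_ideal_gen_iff:
  "(monomial m :: ('x, 'k::comm_ring_1) mpoly) \<in> ideal_gen (monomial ` A) \<longleftrightarrow> (\<exists>a\<in>A. \<exists>c. m = a + c)"
  unfolding ideal_gen_monomial by (simp add: monomial_def)

lemma monomial_power: "monomial a ^ p = monomial (\<Sum>i<p. a)"
  by (induction p) (simp_all add: monomial_def mult_single add.commute)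

section \<open>Exponents of the edge ideal and its symbolic powers\<close>

definition edge_exponent :: "'x set \<Rightarrow> 'x \<Rightarrow>\<^sub>0 nat" where
  "edge_exponent e = (\<Sum>x\<in>e. Poly_Mapping.single x 1)"

lemma lookup_edge_exponent:
  "Poly_Mapping.lookup (edge_exponent e) (x :: 'x::finite) = of_bool (x \<in> e)"
  by (simp add: edge_exponent_def lookup_sum lookup_single when_def)

lemma prod_var: "(\<Prod>x\<in>e. var x) = monomial (edge_exponent e)"
  unfolding edge_exponent_def var_def
  by (induction e rule: infinite_finite_induct) (simp_all add: monomial_def mult_single)

lemma edge_ideal_eq: "edge_ideal C = ideal_gen (monomial ` edge_exponent ` C)"
  unfolding edge_ideal_def prod_var image_image by (simp add: Setcompr_eq_image)

text \<open>For a monomial, this is the exponent of the largest power of the prime ideal generated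
  by \<open>V\<close> that contains it.\<close>

definition weight :: "'x set \<Rightarrow> ('x \<Rightarrow>\<^sub>0 nat) \<Rightarrow> nat" where
  "weight V m = (\<Sum>x\<in>V. Poly_Mapping.lookup m x)"

lemma weight_add: "weight V (a + b) = weight V a + weight V b"
  by (simp add: weight_def lookup_add sum.distrib)

lemma weight_sum_list: "weight V (sum_list as) = (\<Sum>a\<leftarrow>as. weight V a)"
  by (induction as) (simp_all add: weight_add weight_def[of V 0])

lemma weight_sum_const: "weight V (\<Sum>i<p. a) = p * weight V a"
  by (simp add: weight_def lookup_sum sum_distrib_left)

lemma weight_edge_exponent:
  fixes V :: "'x::finite set"
  assumes "V \<inter> e \<noteq> {}"
  shows "1 \<le> weight V (edge_exponent e)"
proof -
  obtain x where "x \<in> V" "x \<in> e" using assms by blast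
  then have "Poly_Mapping.lookup (edge_exponent e) x \<le> weight V (edge_exponent e)"
    unfolding weight_def by (intro member_le_sum) auto
  then show ?thesis
    using \<open>x \<in> e\<close> by (simp add: lookup_edge_exponent)
qed

text \<open>Easy half of the duality: each of the \<open>n\<close> edges meets the cover and so
  contributes at least 1.\<close>

lemma weight_nfold_edges:
  fixes V :: "'x::finite set"
  assumes "vertex_cover C V" "s \<in> nfold_sums (edge_exponent ` C) n"
  shows "n \<le> weight V s"
proof -
  obtain as where as: "s = sum_list as" "length as = n" "set as \<subseteq> edge_exponent ` C"
    using assms(2) unfolding nfold_sums_def by blast
  have "1 \<le> weight V a" if "a \<in> set as" for a
  proof -
    obtain e where "e \<in> C" "a = edge_exponent e" using \<open>a \<in> set as\<close> as(3) by blast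
    then show ?thesis
      using assms(1) weight_edge_exponent[of V e] by (simp add: vertex_cover_def)
  qed
  then have "(\<Sum>a\<leftarrow>as. 1) \<le> (\<Sum>a\<leftarrow>as. weight V a)"
    by (rule sum_list_mono)
  then show ?thesis
    using as(1,2) by (simp add: weight_sum_list sum_list_triv)
qed

text \<open>Describes the monomials in powers of the prime of \<open>V\<close>. Conversely,
  variables of \<open>V\<close> that occur in \<open>m\<close> are split off one at a time, each
  lowering the weight by exactly 1.\<close>

lemma nfold_variables_multiple_iff:
  fixes V :: "'x::finite set"
  shows "(\<exists>s\<in>nfold_sums ((\<lambda>x. Poly_Mapping.single x 1) ` V) n. \<exists>c. m = s + c) \<longleftrightarrow> n \<le> weight V m"
proof
  assume "\<exists>s\<in>nfold_sums ((\<lambda>x. Poly_Mapping.single x 1) ` V) n. \<exists>c. m = s + c"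
  then obtain as c where as: "m = sum_list as + c" "length as = n"
    "set as \<subseteq> (\<lambda>x. Poly_Mapping.single x 1) ` V"
    unfolding nfold_sums_def by blast
  have "weight V a = 1" if "a \<in> set as" for a
    using that as(3) by (auto simp: weight_def lookup_single when_def)
  then have "(\<Sum>a\<leftarrow>as. weight V a) = n"
    using as(2) by (simp add: sum_list_triv cong: map_cong)
  then show "n \<le> weight V m"
    using as(1) by (simp add: weight_add weight_sum_list)
next
  assume "n \<le> weight V m"
  then show "\<exists>s\<in>nfold_sums ((\<lambda>x. Poly_Mapping.single x 1) ` V) n. \<exists>c. m = s + c"
  proof (induction n arbitrary: m)
    case 0
    show ?case by simp
  next
    case (Suc n)
    then obtain x where x: "x \<in> V" "Poly_Mapping.lookup m x \<noteq> 0"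
      unfolding weight_def by (metis Suc_n_not_le_n le_trans sum.neutral zero_le)
    define m' where "m' = m - Poly_Mapping.single x 1"
    have m: "m = Poly_Mapping.single x 1 + m'"
      using x(2) by (auto simp: m'_def poly_mapping_eq_iff fun_eq_iff lookup_add lookup_minus
          lookup_single when_def)
    have "weight V (Poly_Mapping.single x 1) = 1"
      using x(1) by (simp add: weight_def lookup_single when_def)
    then have "n \<le> weight V m'"
      using Suc.prems by (subst (asm) m) (simp add: weight_add)
    then obtain s c where sc: "s \<in> nfold_sums ((\<lambda>x. Poly_Mapping.single x 1) ` V) n" "m' = s + c"
      using Suc.IH by blast
    have "Poly_Mapping.single x 1 + s \<in> nfold_sums ((\<lambda>x. Poly_Mapping.single x 1) ` V) (Suc n)"
        "m = (Poly_Mapping.single x 1 + s) + c"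
      unfolding nfold_sums_Suc using x(1) sc(1) m sc(2) by (blast, simp only: add.assoc)
    then show ?case by blast
  qed
qed

text \<open>Each prime power imposes a weight bound on every exponent of the support, and the
  intersection collects these bounds.\<close>

lemma symbolic_power_eq:
  "symbolic_power C n = {f :: ('x::finite, 'k::comm_ring_1) mpoly.
    \<forall>m\<in>Poly_Mapping.keys f. \<forall>V. minimal_vertex_cover C V \<longrightarrow> n \<le> weight V m}"
proof -
  have "ideal_pow (ideal_gen (var ` V)) n
      = {f :: ('x, 'k) mpoly. \<forall>m\<in>Poly_Mapping.keys f. n \<le> weight V m}" for V
  proof -
    have "var ` V = (monomial ` (\<lambda>x. Poly_Mapping.single x 1) ` V :: ('x, 'k) mpoly set)"
      by (simp add: var_def image_image)
    then have "ideal_pow (ideal_gen (var ` V)) n = (ideal_gen (monomial `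
        nfold_sums ((\<lambda>x. Poly_Mapping.single x 1) ` V) n) :: ('x, 'k) mpoly set)"
      by (simp only: ideal_pow_monomial)
    then show ?thesis
      by (simp only: ideal_gen_monomial nfold_variables_multiple_iff)
  qed
  then show ?thesis unfolding symbolic_power_def by auto
qed

text \<open>The combinatorial core in terms of exponents: one direction counts weights, the other is
  \<open>clique_packing\<close> with the exponents of \<open>m\<close> as capacities.\<close>

lemma nfold_cliques_multiple_iff:
  fixes r :: "'x::finite rel"
  assumes "partial_order_on UNIV r"
  defines "C \<equiv> clique_clutter (comparability_graph r)"
  shows "(\<exists>s\<in>nfold_sums (edge_exponent ` C) n. \<exists>c. m = s + c) \<longleftrightarrow>
    (\<forall>V. minimal_vertex_cover C V \<longrightarrow> n \<le> weight V m)"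
proof
  assume "\<exists>s\<in>nfold_sums (edge_exponent ` C) n. \<exists>c. m = s + c"
  then obtain s c where s: "s \<in> nfold_sums (edge_exponent ` C) n" and m: "m = s + c" by blast
  show "\<forall>V. minimal_vertex_cover C V \<longrightarrow> n \<le> weight V m"
    using weight_nfold_edges[OF _ s] by (simp add: m minimal_vertex_cover_def weight_add trans_le_add1)
next
  assume "\<forall>V. minimal_vertex_cover C V \<longrightarrow> n \<le> weight V m"
  then obtain es where es: "length es = n" "set es \<subseteq> C"
    "\<And>x. (\<Sum>e\<leftarrow>es. of_bool (x \<in> e)) \<le> Poly_Mapping.lookup m x"
    using clique_packing[OF assms(1), of n "Poly_Mapping.lookup m"] unfolding C_def weight_def by blast
  define s where "s = sum_list (map edge_exponent es)"
  have "Poly_Mapping.lookup s x = (\<Sum>e\<leftarrow>es. of_bool (x \<in> e))" for x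
    unfolding s_def by (induction es) (simp_all add: lookup_add lookup_edge_exponent)
  \<comment> \<open>Subtraction is truncated, but exact here because \<open>s\<close> is pointwise
    at most \<open>m\<close>.\<close>
  then have "m = s + (m - s)"
    using es(3) by (simp add: poly_mapping_eq_iff fun_eq_iff lookup_add lookup_minus)
  moreover have "s \<in> nfold_sums (edge_exponent ` C) n"
    using es(1,2) unfolding nfold_sums_def s_def
    by (intro CollectI exI[of _ "map edge_exponent es"]) auto
  ultimately show "\<exists>s\<in>nfold_sums (edge_exponent ` C) n. \<exists>c. m = s + c"
    by blast
qed

section \<open>Torsion freeness and normality by comparison of exponents\<close>

theorem theorem4p2p2:
  fixes r :: "'x::finite rel"
  assumes "partial_order_on UNIV r"
  shows "normally_torsion_free TYPE('k::field) (clique_clutter (comparability_graph r)) \<and>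
         normal_ideal (edge_ideal (clique_clutter (comparability_graph r)) :: ('x, 'k) mpoly set)"
proof -
  define C where "C = clique_clutter (comparability_graph r)"
  define I :: "('x, 'k) mpoly set" where "I = edge_ideal C"
  note multiple_iff = nfold_cliques_multiple_iff[OF assms, folded C_def]
  have pow: "ideal_pow I n = ideal_gen (monomial ` nfold_sums (edge_exponent ` C) n)" for n
    by (simp add: I_def edge_ideal_eq ideal_pow_monomial)
  \<comment> \<open>Both sides become the set of polynomials whose exponents satisfy the same weight
    bounds.\<close>
  have "ideal_pow I n = symbolic_power C n" for n
    unfolding pow ideal_gen_monomial multiple_iff symbolic_power_eq ..
  moreover have "ideal_pow I n = integral_closure_pow I n" for n
  proof
    show "ideal_pow I n \<subseteq> integral_closure_pow I n"
      unfolding integral_closure_pow_def pow[of n]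
    proof (intro ideal_gen_mono subsetI)
      fix f :: "('x, 'k) mpoly"
      assume f: "f \<in> monomial ` nfold_sums (edge_exponent ` C) n"
      then obtain a where a: "f = monomial a" by blast
      have "monomial a ^ 1 \<in> ideal_pow I (1 * n)"
        using ideal_gen_base[OF f] by (simp only: pow a power_one_right mult_1)
      then have "\<exists>p\<ge>1. monomial a ^ p \<in> ideal_pow I (p * n)"
        by (intro exI[of _ 1] conjI order_refl)
      with a show "f \<in> {monomial a | a. \<exists>p\<ge>1. monomial a ^ p \<in> ideal_pow I (p * n)}"
        by (intro CollectI exI[of _ a] conjI)
    qed
    have "monomial a \<in> ideal_pow I n"
      if "p \<ge> 1" "(monomial a :: ('x, 'k) mpoly) ^ p \<in> ideal_pow I (p * n)" for a p
    proof -
      \<comment> \<open>Weights scale with \<open>p\<close>, so the factor \<open>p \<ge> 1\<close>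
        cancels and leaves the bounds for \<open>a\<close> itself.\<close>
      have "p * n \<le> p * weight V a" if "minimal_vertex_cover C V" for V
        using \<open>monomial a ^ p \<in> _\<close> that
        unfolding pow monomial_power monomial_in_ideal_gen_iff multiple_iff weight_sum_const by blast
      then show ?thesis
        using \<open>p \<ge> 1\<close> unfolding pow monomial_in_ideal_gen_iff multiple_iff by auto
    qed
    then have "{monomial a | a. \<exists>p\<ge>1. monomial a ^ p \<in> ideal_pow I (p * n)} \<subseteq> ideal_pow I n"
      by blast
    then show "integral_closure_pow I n \<subseteq> ideal_pow I n"
      unfolding integral_closure_pow_def pow[of n] by (rule ideal_gen_subset)
  qed
  ultimately show ?thesis
    by (simp add: normally_torsion_free_def normal_ideal_def I_def C_def)
qed

end
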